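(* Let $\mu$ be a nontrivial probability measure on $\partial\mathbb{D}$ with monic orthogonal polynomials $\Phi_n$. Then $\arg(\Phi_n(e^{i\theta}))$ (chosen continuously) is monotone increasing in $\theta$ on $\partial\mathbb{D}$ and defines a measure $\frac{d\arg(\Phi_n(e^{i\theta}))}{d\theta}$ on $\partial\mathbb{D}$ of total mass $2\pi n$. If the density of zeros $d\nu_n$ has a (weak) limit $d\nu$ supported on $\partial\mathbb{D}$ as $n\to\infty$, then $$\frac1{2\pi n}\,\frac{d\arg(\Phi_n(e^{i\theta}))}{d\theta}\to\frac12\,d\nu+\frac12\,\frac{d\theta}{2\pi}$$ weakly.
   Context: $\mathbb{D}=\{|z|<1\}$. A probability measure on $\partial\mathbb{D}$ is nontrivial if it is not a finite combination of delta functions. $\Phi_n$ is the monic orthogonal polynomial of degree $n$ in $L^2(\partial\mathbb{D},d\mu)$; all its zeros lie in $\mathbb{D}$. The density of zeros $d\nu_n$ is the probability measure giving weight $m/n$ to each zero of $\Phi_n$ of multiplicity $m$. The expression $\frac{d\arg(\Phi_n(e^{i\theta}))}{d\theta}$ denotes the measure on $\partial\mathbb{D}$ whose density with respect to $d\theta$ is the $\theta$-derivative of $\arg\Phi_n(e^{i\theta})$. *)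

theory Defs
  imports "HOL-Probability.Probability" "HOL-Computational_Algebra.Computational_Algebra"
begin

(* Measures on the unit circle are Borel measures on the complex plane that are carried by the
   circle; the circle is closed, so "carried by" is the same as "supported on". *)

definition circle_prob_measure :: "complex measure \<Rightarrow> bool" where
  "circle_prob_measure M \<longleftrightarrow>
     prob_space M \<and> sets M = sets borel \<and> emeasure M (- sphere 0 1) = 0"

definition nontrivial_measure :: "complex measure \<Rightarrow> bool" where
  "nontrivial_measure M \<longleftrightarrow>
     \<not> (\<exists>(S :: complex set) (w :: complex \<Rightarrow> ennreal). finite S \<and>
          (\<forall>A \<in> sets M. emeasure M A = (\<Sum>s\<in>S. w s * emeasure (return borel s) A)))"

definition monic_orthogonal_polys :: "complex measure \<Rightarrow> (nat \<Rightarrow> complex poly) \<Rightarrow> bool" where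
  "monic_orthogonal_polys M \<Phi> \<longleftrightarrow>
     (\<forall>n. degree (\<Phi> n) = n \<and> lead_coeff (\<Phi> n) = 1) \<and>
     (\<forall>m n. m \<noteq> n \<longrightarrow> (\<integral>z. cnj (poly (\<Phi> m) z) * poly (\<Phi> n) z \<partial>M) = 0)"

(* proots p is the multiset of zeros of p, so a zero of multiplicity m gets weight m / degree p.
   Only meaningful for degree p > 0. *)
definition zero_density :: "complex poly \<Rightarrow> complex measure" where
  "zero_density p = distr (measure_pmf (pmf_of_multiset (proots p))) borel (\<lambda>z. z)"

definition continuous_arg :: "complex poly \<Rightarrow> (real \<Rightarrow> real) \<Rightarrow> bool" where
  "continuous_arg p \<phi> \<longleftrightarrow> continuous_on UNIV \<phi> \<and>
     (\<forall>\<theta>. poly p (cis \<theta>) \<noteq> 0 \<and> is_Arg (poly p (cis \<theta>)) (\<phi> \<theta>))"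

(* The measure g(\<theta>) d\<theta> on the unit circle; used for non-negative g only, since ennreal cuts off
   negative values. *)
definition circle_density :: "(real \<Rightarrow> real) \<Rightarrow> complex measure" where
  "circle_density g =
     distr (density (restrict_space lborel {0..<2*pi}) (\<lambda>\<theta>. ennreal (g \<theta>))) borel cis"

definition arg_measure :: "(real \<Rightarrow> real) \<Rightarrow> complex measure" where
  "arg_measure \<phi> = circle_density (deriv \<phi>)"

definition add_measure :: "'a measure \<Rightarrow> 'a measure \<Rightarrow> 'a measure" where
  "add_measure M N = measure_of (space M) (sets M) (\<lambda>A. emeasure M A + emeasure N A)"

lemma space_add_measure [simp]: "space (add_measure M N) = space M"
  and sets_add_measure [simp, measurable_cong]: "sets (add_measure M N) = sets M"
  by (simp_all add: add_measure_def)

lemma emeasure_add_measure: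
  assumes "sets M = sets N" "A \<in> sets M"
  shows "emeasure (add_measure M N) A = emeasure M A + emeasure N A"
proof (rule emeasure_measure_of[OF add_measure_def])
  show "countably_additive (sets (add_measure M N)) (\<lambda>A. emeasure M A + emeasure N A)"
    using assms(1) by (auto simp: countably_additive_def suminf_add [symmetric] suminf_emeasure)
qed (use assms sets.space_closed in \<open>auto simp: positive_def\<close>)

(* Weak convergence for Borel measures on an arbitrary space; the library's weak_conv_m is
   restricted to the real line. *)
definition weak_limit :: "(nat \<Rightarrow> 'a::topological_space measure) \<Rightarrow> 'a measure \<Rightarrow> bool" where
  "weak_limit M N \<longleftrightarrow>
     (\<forall>f :: 'a \<Rightarrow> real. continuous_on UNIV f \<longrightarrow> bounded (range f) \<longrightarrow>
        (\<lambda>n. \<integral>x. f x \<partial>M n) \<longlonglongrightarrow> (\<integral>x. f x \<partial>N))"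

end

theory Submission
  imports Defs "HOL-Complex_Analysis.Complex_Analysis"
begin

text \<open>
  For a zero \<open>w\<close> of \<open>\<Phi> n\<close>, write \<open>\<Phi> n = (z - w) q\<close>. Since \<open>q\<close> is orthogonal to \<open>\<Phi> n\<close> and
  multiplication by \<open>z\<close> is an isometry, \<open>(1 - |w|\<^sup>2) \<parallel>q\<parallel>\<^sup>2 = \<parallel>\<Phi> n\<parallel>\<^sup>2 > 0\<close>, so \<open>|w| < 1\<close>. Each zero contributes
  \<open>Re (e\<^bsup>i\<theta>\<^esup> / (e\<^bsup>i\<theta>\<^esup> - w)) = (1 + P\<^bsub>w\<^esub>(\<theta>)) / 2\<close> to the derivative of the argument, where \<open>P\<^bsub>w\<^esub>\<close> is the
  Poisson kernel. Integrating the real part of a polynomial against it gives the average of the values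
  at \<open>w\<close> and at \<open>0\<close>, times \<open>2\<pi>\<close>; summing over the zeros turns the left-hand side into half of the density
  of zeros plus half of the value at \<open>0\<close>, which is the mean over the circle. Real parts of
  polynomials are uniformly dense in the continuous functions on the circle.
\<close>

section \<open>Zeros of the orthogonal polynomials\<close>

lemma circle_prob_measure_AE:
  assumes "circle_prob_measure M"
  shows "AE z in M. norm z = 1"
proof (rule AE_I')
  show "- sphere 0 1 \<in> null_sets M"
    using assms by (auto simp: circle_prob_measure_def null_sets_def)
qed auto

text \<open>\<open>f\<close> may be unbounded on the plane, but it is bounded on the compact circle,
  which carries all the mass.\<close>

lemma integrable_circle:
  fixes f :: "complex \<Rightarrow> 'b :: {banach, second_countable_topology}"
  assumes M: "circle_prob_measure M" and f: "continuous_on UNIV f"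
  shows "integrable M f"
proof -
  interpret prob_space M using M by (simp add: circle_prob_measure_def)
  have sets: "sets M = sets borel" using M by (simp add: circle_prob_measure_def)
  have "bounded (f ` sphere 0 1)"
    by (intro compact_imp_bounded compact_continuous_image continuous_on_subset[OF f]) auto
  then obtain B where "\<forall>z\<in>sphere 0 1. norm (f z) \<le> B"
    unfolding bounded_iff by auto
  moreover have "f \<in> borel_measurable M"
    using f sets borel_measurable_continuous_onI measurable_cong_sets by blast
  ultimately show ?thesis
    using circle_prob_measure_AE[OF M] by (intro integrable_const_bound[of _ B]) auto
qed

lemma integral_circle_cong:
  fixes f g :: "complex \<Rightarrow> 'b :: {banach, second_countable_topology}"
  assumes M: "circle_prob_measure M" and f: "continuous_on UNIV f" and g: "continuous_on UNIV g"
    and eq: "\<And>z. norm z = 1 \<Longrightarrow> f z = g z"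
  shows "integral\<^sup>L M f = integral\<^sup>L M g"
  using circle_prob_measure_AE[OF M] integrable_circle[OF M f] integrable_circle[OF M g] eq
  by (intro integral_cong_AE) auto

text \<open>Total mass 1 turns a uniform bound on the circle into the same bound for the integrals.
  The error of replacing a test function is thus independent of the measure, hence uniform along a
  sequence.\<close>

lemma circle_integral_diff_le:
  fixes f g :: "complex \<Rightarrow> real"
  assumes M: "circle_prob_measure M" and f: "continuous_on UNIV f" and g: "continuous_on UNIV g"
    and le: "\<And>z. norm z = 1 \<Longrightarrow> \<bar>f z - g z\<bar> \<le> e"
  shows "\<bar>integral\<^sup>L M f - integral\<^sup>L M g\<bar> \<le> e"
proof -
  interpret prob_space M using M by (simp add: circle_prob_measure_def)
  have i: "integrable M f" "integrable M g" using integrable_circle[OF M] f g by blast+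
  have "\<bar>integral\<^sup>L M f - integral\<^sup>L M g\<bar> = \<bar>\<integral>z. f z - g z \<partial>M\<bar>"
    using i by simp
  also have "\<dots> \<le> (\<integral>z. \<bar>f z - g z\<bar> \<partial>M)" by (rule integral_abs_bound)
  also have "\<dots> \<le> (\<integral>z. e \<partial>M)"
    using i circle_prob_measure_AE[OF M] le by (intro integral_mono_AE) auto
  finally show ?thesis by (simp add: prob_space)
qed

text \<open>If the integral vanished, \<open>M\<close> would be carried by the finitely many zeros
  of \<open>p\<close> and so be a combination of point masses with weights
  \<open>emeasure M {s}\<close>.\<close>

lemma nontrivial_measure_integral_pos:
  assumes M: "circle_prob_measure M" and nt: "nontrivial_measure M" and p: "p \<noteq> 0"
  shows "(\<integral>z. (norm (poly p z))\<^sup>2 \<partial>M) > 0"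
proof (rule ccontr)
  have sets: "sets M = sets borel" using M by (simp add: circle_prob_measure_def)
  have int: "integrable M (\<lambda>z. (norm (poly p z))\<^sup>2)"
    by (intro integrable_circle[OF M] continuous_intros)
  assume "\<not> ?thesis"
  moreover have "(\<integral>z. (norm (poly p z))\<^sup>2 \<partial>M) \<ge> 0" by simp
  ultimately have "(\<integral>z. (norm (poly p z))\<^sup>2 \<partial>M) = 0" by linarith
  then have AE: "AE z in M. poly p z = 0"
    using integral_nonneg_eq_0_iff_AE[OF int] by simp
  define S where "S = {z. poly p z = 0}"
  have fin: "finite S" using p by (simp add: S_def poly_roots_finite)
  have "emeasure M A = (\<Sum>s\<in>S. emeasure M {s} * emeasure (return borel s) A)" if A: "A \<in> sets M" for A
  proof -
    have "emeasure M A = emeasure M (A \<inter> S)"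
      using AE A fin by (intro emeasure_eq_AE) (auto simp: S_def sets finite_imp_closed borel_closed)
    also have "\<dots> = (\<Sum>s\<in>A \<inter> S. emeasure M {s})"
      using fin by (intro emeasure_eq_sum_singleton) (auto simp: sets)
    also have "\<dots> = (\<Sum>s\<in>S. emeasure M {s} * indicator A s)"
      using fin by (intro sum.mono_neutral_cong_left) (auto split: split_indicator)
    also have "\<dots> = (\<Sum>s\<in>S. emeasure M {s} * emeasure (return borel s) A)"
      using A sets by simp
    finally show ?thesis .
  qed
  then have "\<exists>S w. finite S \<and> (\<forall>A\<in>sets M. emeasure M A = (\<Sum>s\<in>S. w s * emeasure (return borel s) A))"
    using fin by (intro exI[of _ S] exI[of _ "\<lambda>s. emeasure M {s}"] conjI ballI)
  with nt show False
    by (simp only: nontrivial_measure_def not_True_eq_False)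
qed

text \<open>Subtracting a multiple of the monic \<open>\<Phi> m\<close> with
  \<open>m = degree q\<close> removes the leading term of \<open>q\<close>; the remainder is handled
  by induction on the degree.\<close>

lemma monic_orthogonal_polys_orthogonal:
  assumes M: "circle_prob_measure M" and \<Phi>: "monic_orthogonal_polys M \<Phi>" and q: "degree q < n"
  shows "(\<integral>z. cnj (poly q z) * poly (\<Phi> n) z \<partial>M) = 0"
  using q
proof (induction "degree q" arbitrary: q rule: less_induct)
  case less
  define m c where "m = degree q" and "c = lead_coeff q"
  define r where "r = q - smult c (\<Phi> m)"
  have deg: "degree (\<Phi> m) = m" "lead_coeff (\<Phi> m) = 1" 
    and orth: "(\<integral>z. cnj (poly (\<Phi> m) z) * poly (\<Phi> n) z \<partial>M) = 0"
    using \<Phi> less.prems unfolding monic_orthogonal_polys_def m_def by (blast, blast, simp)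
  have int: "integrable M (\<lambda>z. cnj (poly a z) * poly b z)" for a b
    by (intro integrable_circle[OF M] continuous_intros)
  have "(\<integral>z. cnj (poly r z) * poly (\<Phi> n) z \<partial>M) = 0"
  \<comment> \<open>A vanishing remainder is treated apart: the zero polynomial has degree 0, which
    is not a strict drop when \<open>m = 0\<close>.\<close>
  proof (cases "r = 0")
    case False
    have "degree r \<le> m"
      unfolding r_def using deg m_def by (intro degree_diff_le) (auto intro: order.trans[OF degree_smult_le])
    moreover have "coeff r m = 0"
      using deg by (simp add: r_def c_def m_def)
    ultimately have "degree r < m"
      using False by (metis eq_zero_or_degree_less)
    then show ?thesis
      using less.hyps[of r] less.prems by (simp add: m_def)
  qed auto
  moreover have "cnj (poly q z) * poly (\<Phi> n) z =
      cnj (poly r z) * poly (\<Phi> n) z + cnj c * (cnj (poly (\<Phi> m) z) * poly (\<Phi> n) z)" for z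
    by (simp add: r_def algebra_simps)
  ultimately show ?case
    using int orth by simp
qed

lemma orthogonal_poly_roots_in_disc:
  assumes M: "circle_prob_measure M" and nt: "nontrivial_measure M"
    and \<Phi>: "monic_orthogonal_polys M \<Phi>" and w: "poly (\<Phi> n) w = 0"
  shows "norm w < 1"
proof -
  obtain q where q: "\<Phi> n = [:- w, 1:] * q"
    using w by (auto simp: poly_eq_0_iff_dvd elim: dvdE)
  have lc: "lead_coeff (\<Phi> n) = 1" "degree (\<Phi> n) = n"
    using \<Phi> unfolding monic_orthogonal_polys_def by blast+
  then have nz: "\<Phi> n \<noteq> 0" by auto
  with q have qnz: "q \<noteq> 0" by auto
  have "degree (\<Phi> n) = Suc (degree q)"
    unfolding q using qnz by (subst degree_mult_eq) auto
  then have "degree q < n" using lc by simp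
  then have orth: "(\<integral>z. cnj (poly q z) * poly (\<Phi> n) z \<partial>M) = 0"
    by (rule monic_orthogonal_polys_orthogonal[OF M \<Phi>])
  define P Q where "P = (\<integral>z. (norm (poly (\<Phi> n) z))\<^sup>2 \<partial>M)" and "Q = (\<integral>z. (norm (poly q z))\<^sup>2 \<partial>M)"
  have int: "integrable M (\<lambda>z. (norm (poly a z))\<^sup>2)" "integrable M (\<lambda>z. cnj (poly a z) * poly b z)"
    "integrable M (\<lambda>z. Re (c * (cnj (poly a z) * poly b z)))" for a b c
    by (intro integrable_circle[OF M] continuous_intros)+
  \<comment> \<open>On the circle \<open>q\<close> and \<open>z * q\<close> have the same modulus,
    and \<open>z * q\<close> equals \<open>\<Phi> n + w * q\<close>. The cross term in the expanded
    square integrates to 0 by orthogonality.\<close>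
  have norm_eq: "(norm (poly q z))\<^sup>2 = (norm (poly (\<Phi> n) z))\<^sup>2 + 2 * Re (cnj w * (cnj (poly q z) * poly (\<Phi> n) z))
      + (norm w)\<^sup>2 * (norm (poly q z))\<^sup>2" if "norm z = 1" for z
  proof -
    have "(norm (poly q z))\<^sup>2 = (norm (z * poly q z))\<^sup>2" using that by (simp add: norm_mult)
    also have "z * poly q z = poly (\<Phi> n) z + w * poly q z" by (simp add: q algebra_simps)
    also have "(norm \<dots>)\<^sup>2 = (norm (poly (\<Phi> n) z))\<^sup>2 + 2 * Re (cnj w * (cnj (poly q z) * poly (\<Phi> n) z))
      + (norm w)\<^sup>2 * (norm (poly q z))\<^sup>2"
      unfolding cmod_power2 by (simp add: algebra_simps power2_eq_square)
    finally show ?thesis .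
  qed
  define X where "X = (\<lambda>z. Re (cnj w * (cnj (poly q z) * poly (\<Phi> n) z)))"
  have X: "integrable M X" unfolding X_def by (rule int)
  have "Q = (\<integral>z. (norm (poly (\<Phi> n) z))\<^sup>2 + 2 * X z + (norm w)\<^sup>2 * (norm (poly q z))\<^sup>2 \<partial>M)"
    unfolding Q_def X_def by (intro integral_circle_cong[OF M] continuous_intros norm_eq)
  also have "\<dots> = P + 2 * integral\<^sup>L M X + (norm w)\<^sup>2 * Q"
    unfolding P_def Q_def using int(1) X by simp
  also have "integral\<^sup>L M X = 0"
    unfolding X_def using int(2)[of q "\<Phi> n"] by (subst integral_Re) (simp_all add: orth)
  finally have "Q * (1 - (norm w)\<^sup>2) = P" by (simp add: algebra_simps)
  moreover have "P > 0" "Q > 0"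
    unfolding P_def Q_def using nontrivial_measure_integral_pos[OF M nt] nz qnz by auto
  ultimately have "(norm w)\<^sup>2 < 1"
    using zero_less_mult_pos[of Q "1 - (norm w)\<^sup>2"] by simp
  then show ?thesis using power2_less_imp_less[of "norm w" 1] by simp
qed

section \<open>Derivative of the argument\<close>

definition arg_kernel :: "complex \<Rightarrow> real \<Rightarrow> real" where
  "arg_kernel w \<theta> = Re (cis \<theta> / (cis \<theta> - w))"

lemma continuous_on_arg_kernel: "norm w < 1 \<Longrightarrow> continuous_on S (arg_kernel w)"
  unfolding arg_kernel_def by (intro continuous_intros) auto

text \<open>The real part of \<open>a / b\<close> has the sign of \<open>Re (a * cnj b)\<close>,
  which is here \<open>1 - Re (w * cnj (cis \<theta>))\<close>.\<close>

lemma arg_kernel_nonneg: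
  assumes "norm w < 1"
  shows "arg_kernel w \<theta> \<ge> 0"
proof -
  have "Re (w * cnj (cis \<theta>)) \<le> norm (w * cnj (cis \<theta>))" by (rule complex_Re_le_cmod)
  also have "\<dots> \<le> 1" using assms by (simp add: norm_mult)
  finally have "Re (w * cnj (cis \<theta>)) \<le> (cos \<theta>)\<^sup>2 + (sin \<theta>)\<^sup>2" by simp
  then have "Re (cis \<theta>) * Re (cis \<theta> - w) + Im (cis \<theta>) * Im (cis \<theta> - w) \<ge> 0"
    by (simp add: algebra_simps power2_eq_square del: sin_cos_squared_add2 sin_cos_squared_add3)
  then show ?thesis
    unfolding arg_kernel_def Re_divide' by (intro divide_nonneg_nonneg) auto
qed

text \<open>Cauchy's formula with \<open>u = cis t\<close>, where
  \<open>du = \<i> * cis t dt\<close>; the factor \<open>\<i>\<close> cancels. A general open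
  \<open>S\<close> leaves room for functions with a pole outside the closed disc.\<close>

lemma Cauchy_integral_cis:
  fixes f :: "complex \<Rightarrow> complex"
  assumes f: "f holomorphic_on S" "open S" "cball 0 1 \<subseteq> S" and w: "norm w < 1"
  shows "((\<lambda>\<theta>. f (cis \<theta>) * (cis \<theta> / (cis \<theta> - w))) has_integral 2 * pi * f w) {0..2*pi}"
proof -
  have "((\<lambda>u. f u / (u - w)) has_contour_integral 2 * pi * \<i> * f w) (circlepath 0 1)"
  proof -
    have "f holomorphic_on cball 0 1" using f by (auto intro: holomorphic_on_subset)
    then show ?thesis
      using Cauchy_integral_circlepath[of 0 1 f w] w
      by (auto intro: holomorphic_on_imp_continuous_on holomorphic_on_subset[OF _ ball_subset_cball])
  qed
  then have "((\<lambda>t. f (cis t) / (cis t - w) * \<i> * cis t) has_integral 2 * pi * \<i> * f w) {0..2*pi}"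
    by (simp add: circlepath_def has_contour_integral_part_circlepath_iff)
  from has_integral_mult_right[OF this, of "-\<i>"] show ?thesis
    by (simp add: field_simps)
qed

text \<open>Twice the kernel is the Cauchy kernel plus its conjugate. The first summand produces the
  value of \<open>q\<close> at \<open>w\<close>, the second the value at 0.\<close>

lemma has_integral_poly_arg_kernel:
  assumes w: "norm w < 1"
  shows "((\<lambda>\<theta>. Re (poly q (cis \<theta>)) * arg_kernel w \<theta>) has_integral
           pi * (Re (poly q w) + Re (poly q 0))) {0..2*pi}"
proof -
  have 1: "((\<lambda>\<theta>. poly q (cis \<theta>) * (cis \<theta> / (cis \<theta> - w))) has_integral 2 * pi * poly q w) {0..2*pi}"
    using w by (intro Cauchy_integral_cis[where S = UNIV] holomorphic_intros) auto
  \<comment> \<open>The conjugate kernel is holomorphic in the disc, so it only sees the value at the centre.\<close>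
  define S where "S = {z. cnj w * z \<noteq> 1}"
  have S: "open S" unfolding S_def by (intro open_Collect_neq continuous_intros)
  have "cnj w * z \<noteq> 1" if "norm z \<le> 1" for z
    using w that by (metis complex_mod_cnj mult_le_cancel_left1 norm_ge_zero norm_mult norm_one not_le order.trans mult_left_le)
  then have "cball 0 1 \<subseteq> S" by (auto simp: S_def)
  \<comment> \<open>The factor with \<open>cis \<theta> - 0\<close> equals 1; it puts the integrand
    into the form of Cauchy's formula at the centre.\<close>
  with S have 2: "((\<lambda>\<theta>. poly q (cis \<theta>) / (1 - cnj w * cis \<theta>) * (cis \<theta> / (cis \<theta> - 0))) has_integral
      2 * pi * (poly q 0 / (1 - cnj w * 0))) {0..2*pi}"
    by (intro Cauchy_integral_cis[where S = S] holomorphic_intros) (auto simp: S_def)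
  have eq: "cis \<theta> / (cis \<theta> - w) + 1 / (1 - cnj w * cis \<theta>) = 2 * complex_of_real (arg_kernel w \<theta>)" for \<theta>
  proof -
    have "1 / (1 - cnj w * cis \<theta>) = cnj (cis \<theta> / (cis \<theta> - w))"
      by (simp add: divide_simps cis_cnj flip: cis_inverse)
    then show ?thesis
      using complex_add_cnj[of "cis \<theta> / (cis \<theta> - w)"] by (simp only: arg_kernel_def) simp
  qed
  have "((\<lambda>\<theta>. poly q (cis \<theta>) * (2 * complex_of_real (arg_kernel w \<theta>))) has_integral
      2 * pi * poly q w + 2 * pi * poly q 0) {0..2*pi}"
    using has_integral_add[OF 1 2] unfolding eq[symmetric] by (simp add: algebra_simps)
  from has_integral_linear[OF this bounded_linear_Re] show ?thesis
    by (auto simp: o_def algebra_simps dest: has_integral_mult_right[of _ _ _ "1/2"])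
qed

lemma has_integral_sum_mset:
  assumes "\<And>w. w \<in># A \<Longrightarrow> (f w has_integral I w) S"
  shows "((\<lambda>x. \<Sum>w\<in>#A. f w x) has_integral (\<Sum>w\<in>#A. I w)) S"
  using assms by (induction A) (auto intro: has_integral_add)

text \<open>Based on the factorisation
  \<open>cis \<theta> - w = cis \<theta> * (1 - w * cis (-\<theta>))\<close>. For
  \<open>norm w < 1\<close> the second factor stays in the right half-plane, where \<open>Ln\<close>
  is continuous, so the summand \<theta> carries the whole winding.\<close>

definition arg_lift :: "complex multiset \<Rightarrow> real \<Rightarrow> real" where
  "arg_lift A \<theta> = (\<Sum>w\<in>#A. \<theta> + Im (Ln (1 - w * cis (-\<theta>))))"

lemma one_minus_mult_cis:
  assumes "norm w < 1"
  shows "Re (1 - w * cis \<theta>) > 0" 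
proof -
  have "Re (w * cis \<theta>) \<le> norm (w * cis \<theta>)" by (rule complex_Re_le_cmod)
  also have "\<dots> < 1" using assms by (simp add: norm_mult)
  finally show ?thesis by simp
qed

lemma is_Arg_mult:
  assumes "is_Arg z r" "is_Arg w s"
  shows "is_Arg (z * w) (r + s)"
proof -
  have "z * w = (norm z * exp (\<i> * r)) * (norm w * exp (\<i> * s))"
    by (rule arg_cong2[OF assms[unfolded is_Arg_def]])
  also have "\<dots> = norm (z * w) * exp (\<i> * (r + s))"
    by (simp add: norm_mult exp_add algebra_simps)
  finally show ?thesis by (simp add: is_Arg_def)
qed

lemma is_Arg_arg_lift:
  assumes "\<And>w. w \<in># A \<Longrightarrow> norm w < 1"
  shows "is_Arg (poly (\<Prod>w\<in>#A. [:- w, 1:]) (cis \<theta>)) (arg_lift A \<theta>)"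
  using assms
proof (induction A)
  case empty
  show ?case by (simp add: arg_lift_def is_Arg_def)
next
  case (add w A)
  define u where "u = 1 - w * cis (- \<theta>)"
  have "Re u > 0" unfolding u_def using add.prems by (intro one_minus_mult_cis) auto
  then have "u \<noteq> 0" by auto
  then have "is_Arg u (Im (Ln u))" using is_Arg_exp_Im[of "Ln u"] by simp
  moreover have "is_Arg (cis \<theta>) \<theta>" by (simp add: is_Arg_def cis_conv_exp)
  ultimately have "is_Arg (cis \<theta> * u) (\<theta> + Im (Ln u))" by (metis is_Arg_mult)
  moreover have "cis \<theta> * u = cis \<theta> - w" by (simp add: u_def algebra_simps cis_mult)
  ultimately have "is_Arg (poly [:- w, 1:] (cis \<theta>)) (\<theta> + Im (Ln u))" by simp
  moreover have "is_Arg (poly (\<Prod>w\<in>#A. [:- w, 1:]) (cis \<theta>)) (arg_lift A \<theta>)"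
    using add.prems by (intro add.IH) auto
  ultimately have "is_Arg (poly [:- w, 1:] (cis \<theta>) * poly (\<Prod>w\<in>#A. [:- w, 1:]) (cis \<theta>))
      (\<theta> + Im (Ln u) + arg_lift A \<theta>)"
    by (rule is_Arg_mult)
  then show ?case
    by (simp only: arg_lift_def u_def image_mset_add_mset sum_mset.add_mset prod_mset.add_mset poly_mult)
qed

lemma has_real_derivative_sum_mset:
  assumes "\<And>w. w \<in># A \<Longrightarrow> (f w has_real_derivative f' w) (at x)"
  shows "((\<lambda>x. \<Sum>w\<in>#A. f w x) has_real_derivative (\<Sum>w\<in>#A. f' w)) (at x)"
  using assms by (induction A) (auto intro!: derivative_eq_intros)

lemma arg_lift_has_derivative:
  assumes "\<And>w. w \<in># A \<Longrightarrow> norm w < 1"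
  shows "(arg_lift A has_real_derivative (\<Sum>w\<in>#A. arg_kernel w \<theta>)) (at \<theta>)"
  unfolding arg_lift_def
proof (rule has_real_derivative_sum_mset)
  fix w assume "w \<in># A"
  then have w: "norm w < 1" using assms by blast
  define u where "u = 1 - w * cis (- \<theta>)"
  have u: "Re u > 0" unfolding u_def using w by (intro one_minus_mult_cis)
  then have nR: "u \<notin> \<real>\<^sub>\<le>\<^sub>0" and unz: "u \<noteq> 0" by (auto simp: complex_nonpos_Reals_iff)
  have "((\<lambda>t. 1 - w * cis (- t)) has_vector_derivative \<i> * w * cis (-\<theta>)) (at \<theta>)"
  proof (rule has_vector_derivative_eq_rhs)
    show "((\<lambda>t. 1 - w * cis (- t)) has_vector_derivative 0 - w * ((- 1) *\<^sub>R (\<i> * cis (-\<theta>)))) (at \<theta>)"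
      by (intro derivative_intros
          vector_diff_chain_at[of uminus "-1" \<theta> cis "\<i> * cis (-\<theta>)", unfolded o_def])
        (auto simp: has_vector_derivative_def scaleR_conv_of_real intro!: derivative_eq_intros)
  qed simp
  from field_vector_diff_chain_at[OF this, of Ln] nR
  have "((\<lambda>t. Ln (1 - w * cis (- t))) has_vector_derivative (\<i> * w * cis (-\<theta>)) * inverse u) (at \<theta>)"
    using has_field_derivative_Ln[OF nR] by (simp add: o_def u_def)
  then have "((\<lambda>t. Im (Ln (1 - w * cis (- t)))) has_vector_derivative Im ((\<i> * w * cis (-\<theta>)) * inverse u)) (at \<theta>)"
    by (rule bounded_linear.has_vector_derivative[OF bounded_linear_Im])
  then have "((\<lambda>t. t + Im (Ln (1 - w * cis (- t)))) has_real_derivative 1 + Im ((\<i> * w * cis (-\<theta>)) * inverse u)) (at \<theta>)"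
    by (intro DERIV_add DERIV_ident) (simp only: has_real_derivative_iff_has_vector_derivative)
  \<comment> \<open>Since \<open>u + w * cis (-\<theta>) = 1\<close>, the sum inside the real part
    collapses to \<open>1 / u\<close>; expanding the fraction by \<open>cis \<theta>\<close> gives
    the kernel.\<close>
  moreover have "1 + Im ((\<i> * w * cis (-\<theta>)) * inverse u) = arg_kernel w \<theta>"
  proof -
    have "1 + Im ((\<i> * w * cis (-\<theta>)) * inverse u) = Re (1 + w * cis (-\<theta>) * inverse u)"
      by (simp add: mult.assoc)
    also have "1 + w * cis (-\<theta>) * inverse u = 1 / u"
      using unz by (simp add: field_simps) (simp add: u_def)
    also have "\<dots> = cis \<theta> / (cis \<theta> * u)" using unz by simp
    also have "cis \<theta> * u = cis \<theta> - w" by (simp add: u_def algebra_simps cis_mult)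
    finally show ?thesis by (simp add: arg_kernel_def)
  qed
  ultimately show "((\<lambda>t. t + Im (Ln (1 - w * cis (- t)))) has_real_derivative arg_kernel w \<theta>) (at \<theta>)"
    by simp
qed

text \<open>Both functions are arguments of the same nonzero number, so their difference takes
  values in the multiples of \<open>2 * pi\<close>. A continuous function on the line with values in
  such a discrete set is constant.\<close>

lemma continuous_arg_unique:
  assumes "continuous_arg p \<phi>" "continuous_arg p \<psi>"
  shows "\<exists>c. \<forall>\<theta>. \<phi> \<theta> = \<psi> \<theta> + c"
proof -
  define d where "d = (\<lambda>\<theta>. \<phi> \<theta> - \<psi> \<theta>)"
  have d: "\<exists>k::int. d \<theta> = of_int k * (2 * pi)" for \<theta>
  proof -
    have "exp (\<i> * \<phi> \<theta>) = exp (\<i> * \<psi> \<theta>)"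
      using assms unfolding continuous_arg_def is_Arg_def
      by (metis mult_cancel_left norm_eq_zero of_real_eq_0_iff)
    then obtain k :: int where "\<i> * \<phi> \<theta> = \<i> * \<psi> \<theta> + (of_int (2 * k) * pi) * \<i>"
      unfolding exp_eq by blast
    then have "Im (\<i> * \<phi> \<theta>) = Im (\<i> * \<psi> \<theta> + (of_int (2 * k) * pi) * \<i>)" by simp
    then show ?thesis by (auto simp: d_def intro!: exI[of _ k])
  qed
  have "d constant_on UNIV"
  proof (rule continuous_discrete_range_constant)
    show "continuous_on UNIV d"
      using assms by (auto simp: d_def continuous_arg_def intro!: continuous_intros)
    show "\<exists>e>0. \<forall>y. y \<in> UNIV \<and> d y \<noteq> d x \<longrightarrow> e \<le> norm (d y - d x)" for x
    proof (intro exI[of _ "2 * pi"] conjI allI impI)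
      fix y assume "y \<in> UNIV \<and> d y \<noteq> d x"
      moreover obtain j k :: int where jk: "d y = j * (2 * pi)" "d x = k * (2 * pi)"
        using d by metis
      ultimately have "j \<noteq> k" by auto
      then have "\<bar>real_of_int (j - k)\<bar> \<ge> 1" by linarith
      moreover have "d y - d x = of_int (j - k) * (2 * pi)" by (simp add: jk algebra_simps)
      ultimately show "2 * pi \<le> norm (d y - d x)" by (simp add: abs_mult)
    qed auto
  qed auto
  then obtain c where "d \<theta> = c" for \<theta> unfolding constant_on_def by auto
  then show ?thesis by (intro exI[of _ c]) (simp add: d_def algebra_simps)
qed

text \<open>The explicit lift proves existence. Any other continuous argument differs from it by a
  constant, so differentiability follows from continuity alone, with the same derivative.\<close>

lemma
  fixes p :: "complex poly"
  assumes p: "lead_coeff p = 1" and roots: "\<And>w. poly p w = 0 \<Longrightarrow> norm w < 1"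
  shows continuous_arg_arg_lift: "continuous_arg p (arg_lift (proots p))"
    and continuous_arg_has_derivative: "continuous_arg p \<phi> \<Longrightarrow>
      (\<phi> has_real_derivative (\<Sum>w\<in>#proots p. arg_kernel w \<theta>)) (at \<theta>)"
proof -
  have "p \<noteq> 0" using p by auto
  then have A: "norm w < 1" if "w \<in># proots p" for w
    using that roots by simp
  have deriv: "(arg_lift (proots p) has_real_derivative (\<Sum>w\<in>#proots p. arg_kernel w \<theta>)) (at \<theta>)" for \<theta>
    using A by (rule arg_lift_has_derivative)
  have "(\<Prod>w\<in>#proots p. [:- w, 1:]) = p"
    using complex_poly_decompose_multiset[of p] p by simp
  moreover have "continuous_on UNIV (arg_lift (proots p))"
    using deriv by (meson DERIV_isCont continuous_at_imp_continuous_on)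
  moreover have "poly p (cis \<theta>) \<noteq> 0" for \<theta>
    using roots[of "cis \<theta>"] by auto
  ultimately show lift: "continuous_arg p (arg_lift (proots p))"
    using is_Arg_arg_lift[of "proots p"] A unfolding continuous_arg_def by auto
  assume "continuous_arg p \<phi>"
  then obtain c where "\<phi> = (\<lambda>\<theta>. arg_lift (proots p) \<theta> + c)"
    using continuous_arg_unique[OF _ lift] by (metis ext)
  then show "(\<phi> has_real_derivative (\<Sum>w\<in>#proots p. arg_kernel w \<theta>)) (at \<theta>)"
    using deriv by (auto intro!: derivative_eq_intros)
qed

section \<open>Uniform approximation and integrals on the circle\<close>

text \<open>The induction uses that \<open>z cnj z = 1\<close> cancels one degree from both factors.\<close>

lemma Re_poly_mult_cnj_poly_on_circle:
  "\<exists>c. \<forall>z. norm z = 1 \<longrightarrow> Re (poly a z * cnj (poly b z)) = Re (poly c z)"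
proof (induction a arbitrary: b)
  case 0
  show ?case by (intro exI[of _ 0]) simp
next
  case (pCons \<alpha> a)
  obtain \<beta> b' where b: "b = pCons \<beta> b'" by (cases b)
  obtain c where c: "\<And>z. norm z = 1 \<Longrightarrow> Re (poly a z * cnj (poly b' z)) = Re (poly c z)"
    using pCons.IH by blast
  have "Re (poly (pCons \<alpha> a) z * cnj (poly b z)) =
      Re (poly (smult (cnj \<alpha>) b + pCons 0 (smult (cnj \<beta>) a) + c) z)" if "norm z = 1" for z
  proof -
    have z: "z * cnj z = 1" using that by (simp flip: complex_norm_square)
    have "poly (pCons \<alpha> a) z * cnj (poly b z) =
        \<alpha> * cnj (poly b z) + z * poly a z * cnj \<beta> + (z * cnj z) * (poly a z * cnj (poly b' z))"
      by (simp add: b algebra_simps)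
    then have "Re (poly (pCons \<alpha> a) z * cnj (poly b z)) =
        Re (\<alpha> * cnj (poly b z)) + Re (z * poly a z * cnj \<beta>) + Re (poly a z * cnj (poly b' z))"
      unfolding z by simp
    \<comment> \<open>Conjugating inside the real part moves the conjugation from
      \<open>poly b z\<close> to the coefficient, which leaves a polynomial in
      \<open>z\<close>.\<close>
    also have "Re (\<alpha> * cnj (poly b z)) = Re (cnj \<alpha> * poly b z)" by simp
    also have "Re (poly a z * cnj (poly b' z)) = Re (poly c z)" by (rule c[OF that])
    also have "z * poly a z * cnj \<beta> = z * (cnj \<beta> * poly a z)" by simp
    finally show ?thesis by (simp only: poly_add poly_smult poly_pCons plus_complex.simps add_0)
  qed
  then show ?case by blast
qed

lemma real_polynomial_function_on_circle:
  fixes g :: "complex \<Rightarrow> real"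
  assumes "real_polynomial_function g"
  shows "\<exists>p. \<forall>z. norm z = 1 \<longrightarrow> g z = Re (poly p z)"
  using assms
proof induction
  case (linear f)
  then interpret bounded_linear f .
  \<comment> \<open>A real linear form \<open>a * x + b * y\<close> is the real part of
    \<open>(a - \<i> * b) * z\<close>.\<close>
  have "f z = Re (poly [:0, Complex (f 1) (- f \<i>):] z)" for z
  proof -
    have "f z = f (Re z *\<^sub>R 1 + Im z *\<^sub>R \<i>)"
      by (rule arg_cong[where f = f]) (simp add: complex_eq_iff)
    also have "\<dots> = Re z * f 1 + Im z * f \<i>" by (simp add: add scale)
    finally show ?thesis by simp
  qed
  then show ?case by blast
next
  case (const c)
  show ?case by (intro exI[of _ "[:of_real c:]"]) simp
next
  case (add f g)
  then obtain p q where "\<And>z. norm z = 1 \<Longrightarrow> f z = Re (poly p z)" "\<And>z. norm z = 1 \<Longrightarrow> g z = Re (poly q z)"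
    by blast
  then show ?case by (intro exI[of _ "p + q"]) simp
next
  case (mult f g)
  then obtain p q where pq: "\<And>z. norm z = 1 \<Longrightarrow> f z = Re (poly p z)"
    "\<And>z. norm z = 1 \<Longrightarrow> g z = Re (poly q z)"
    by blast
  obtain c where c: "\<And>z. norm z = 1 \<Longrightarrow> Re (poly p z * cnj (poly q z)) = Re (poly c z)"
    using Re_poly_mult_cnj_poly_on_circle by blast
  \<comment> \<open>For complex numbers, \<open>Re u * Re v\<close> is half of
    \<open>Re (u * v + u * cnj v)\<close>; on the circle the mixed term is again the real part of a
    polynomial.\<close>
  have "f z * g z = Re (poly (smult (1 / 2) (p * q + c)) z)" if "norm z = 1" for z
    using pq[OF that] c[OF that, symmetric] by simp
  then show ?case by blast
qed

text \<open>Stone-Weierstrass on the compact circle gives a polynomial in the real coordinates,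
  which agrees on the circle with the real part of a complex polynomial.\<close>

lemma Weierstrass_Re_poly_circle:
  fixes f :: "complex \<Rightarrow> real"
  assumes "continuous_on UNIV f" "e > 0"
  obtains p where "\<And>z. norm z = 1 \<Longrightarrow> \<bar>f z - Re (poly p z)\<bar> < e"
proof -
  obtain g where g: "real_polynomial_function g" "\<And>z. z \<in> sphere 0 1 \<Longrightarrow> \<bar>f z - g z\<bar> < e"
    using Stone_Weierstrass_real_polynomial_function[of "sphere 0 1" f e] assms
    by (metis compact_sphere continuous_on_subset subset_UNIV)
  obtain p where "\<And>z. norm z = 1 \<Longrightarrow> g z = Re (poly p z)"
    using real_polynomial_function_on_circle[OF g(1)] by blast
  with g(2) show ?thesis by (intro that[of p]) auto
qed

section \<open>Integration against sums and multiples of measures\<close>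

lemma nn_integral_add_measure:
  assumes sets: "sets M = sets N" and f: "f \<in> borel_measurable M"
  shows "integral\<^sup>N (add_measure M N) f = integral\<^sup>N M f + integral\<^sup>N N f"
  using f
proof induction
  case (cong f g)
  then show ?case
    using sets_eq_imp_space_eq[OF sets] by (simp cong: nn_integral_cong_simp)
next
  case (set A)
  then show ?case using sets by (simp add: emeasure_add_measure)
next
  case (mult f c)
  then show ?case
    using sets by (simp add: nn_integral_cmult distrib_left measurable_cong_sets[OF sets])
next
  case (add f g)
  have "borel_measurable (add_measure M N) = (borel_measurable M :: ('a \<Rightarrow> ennreal) set)"
    by (intro measurable_cong_sets) simp_all
  with add show ?case
    by (simp add: nn_integral_add measurable_cong_sets[OF sets] ac_simps)
next
  case (seq U)
  have *: "integral\<^sup>N L (SUP i. U i) = (SUP i. integral\<^sup>N L (U i))" if "sets L = sets M" for L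
  proof -
    have "borel_measurable L = (borel_measurable M :: ('a \<Rightarrow> ennreal) set)"
      using that by (intro measurable_cong_sets) simp_all
    moreover have "(SUP i. U i) = (\<lambda>x. SUP i. U i x)"
      by (simp add: fun_eq_iff image_comp)
    ultimately show ?thesis
      using seq by (simp add: nn_integral_monotone_convergence_SUP)
  qed
  have inc: "incseq (\<lambda>i. integral\<^sup>N L (U i))" for L
    using seq by (auto simp: incseq_def le_fun_def intro!: nn_integral_mono)
  show ?case
    unfolding *[OF sets_add_measure] *[OF refl] *[OF sets[symmetric]] seq.IH
    by (rule ennreal_SUP_add[OF inc inc])
qed

lemma integral_add_measure:
  fixes f :: "'a \<Rightarrow> real"
  assumes sets: "sets M = sets N" and M: "integrable M f" and N: "integrable N f"
  shows "(\<integral>x. f x \<partial>add_measure M N) = (\<integral>x. f x \<partial>M) + (\<integral>x. f x \<partial>N)"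
proof -
  have f [measurable]: "f \<in> borel_measurable M" using M by simp
  have nn: "(\<integral>\<^sup>+x. ennreal (h x) \<partial>add_measure M N) =
      (\<integral>\<^sup>+x. ennreal (h x) \<partial>M) + (\<integral>\<^sup>+x. ennreal (h x) \<partial>N)"
    if "h \<in> borel_measurable M" for h
    using that by (intro nn_integral_add_measure sets) simp
  have "integrable (add_measure M N) f"
    using M N nn[of "\<lambda>x. \<bar>f x\<bar>"] by (simp add: integrable_iff_bounded)
  \<comment> \<open>As \<open>ennreal\<close> cuts off negative values, \<open>h = f\<close> and
    \<open>h = -f\<close> give additivity for the positive and the negative part.\<close>
  then show ?thesis
    using M N nn[of f] nn[of "\<lambda>x. - f x"]
    by (simp add: real_lebesgue_integral_def real_integrable_def enn2real_plus less_top)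
qed

text \<open>Makes the integration rules for densities available for scaled measures.\<close>

lemma scale_measure_eq_density: "scale_measure r M = density M (\<lambda>_. r)"
  by (rule measure_eqI) (auto simp: emeasure_density_const)

lemma integral_scale_measure:
  fixes f :: "'a \<Rightarrow> real"
  assumes "f \<in> borel_measurable M" "r \<ge> 0"
  shows "(\<integral>x. f x \<partial>scale_measure (ennreal r) M) = r * (\<integral>x. f x \<partial>M)"
  using assms by (simp add: scale_measure_eq_density integral_density)

lemma integrable_scale_measure:
  fixes f :: "'a \<Rightarrow> real"
  assumes "integrable M f" "r \<ge> 0"
  shows "integrable (scale_measure (ennreal r) M) f"
  using assms by (simp add: scale_measure_eq_density integrable_density)

section \<open>Measures with a density on the circle\<close>

lemma sets_circle_density [simp, measurable_cong]: "sets (circle_density g) = sets borel"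
  and space_circle_density [simp]: "space (circle_density g) = UNIV"
  by (simp_all add: circle_density_def)

lemma borel_measurable_cis [measurable]: "cis \<in> borel_measurable (restrict_space lborel A)"
  by (intro measurable_restrict_space1) (simp add: borel_measurable_continuous_onI continuous_intros)

text \<open>Links the gauge integral over the closed period, which Cauchy's formula yields, to the
  Lebesgue integral over the half-open period in \<open>circle_density\<close>. The two domains
  differ by one point.\<close>

lemma set_lebesgue_integral_period:
  fixes h :: "real \<Rightarrow> real"
  assumes h: "continuous_on UNIV h" and I: "(h has_integral I) {0..2*pi}"
  shows "set_integrable lborel {0..<2*pi} h" "(LINT \<theta>:{0..<2*pi}|lborel. h \<theta>) = I"
proof -
  have "set_integrable lborel {0..2*pi} h"
    by (intro borel_integrable_atLeastAtMost' continuous_on_subset[OF h]) auto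
  then show int: "set_integrable lborel {0..<2*pi} h"
    by (rule set_integrable_subset) auto
  have "(h has_integral I) {0..<2*pi}"
  proof (rule has_integral_spike_set_eq[THEN iffD1, OF _ _ I])
    show "negligible {x \<in> {0..2*pi} - {0..<2*pi}. h x \<noteq> 0}"
      by (rule negligible_subset[of "{2*pi}"]) auto
  next
    have "{0..<2*pi} - {0..2*pi} = {}" by auto
    then have "{x \<in> {0..<2*pi} - {0..2*pi}. h x \<noteq> 0} = {}" by blast
    then show "negligible {x \<in> {0..<2*pi} - {0..2*pi}. h x \<noteq> 0}"
      by (simp only: negligible_empty)
  qed
  then show "(LINT \<theta>:{0..<2*pi}|lborel. h \<theta>) = I"
    using set_borel_integral_eq_integral(2)[OF int] by (simp add: integral_unique)
qed

lemma integral_circle_density: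
  fixes f :: "complex \<Rightarrow> real"
  assumes f: "continuous_on UNIV f" and g: "continuous_on UNIV g" "\<And>\<theta>. g \<theta> \<ge> 0"
    and I: "((\<lambda>\<theta>. f (cis \<theta>) * g \<theta>) has_integral I) {0..2*pi}"
  shows "(\<integral>z. f z \<partial>circle_density g) = I"
proof -
  have [measurable]: "f \<in> borel_measurable borel" "g \<in> borel_measurable borel"
    using f g by (auto intro: borel_measurable_continuous_onI)
  have "(\<integral>z. f z \<partial>circle_density g) =
      (\<integral>\<theta>. f (cis \<theta>) \<partial>density (restrict_space lborel {0..<2*pi}) g)"
    unfolding circle_density_def by (subst integral_distr) auto
  also have "\<dots> = (\<integral>\<theta>. g \<theta> * f (cis \<theta>) \<partial>restrict_space lborel {0..<2*pi})"
    using g by (subst integral_density) (auto intro: measurable_restrict_space1)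
  also have "\<dots> = (LINT \<theta>:{0..<2*pi}|lborel. f (cis \<theta>) * g \<theta>)"
    by (subst integral_restrict_space) (auto simp: set_lebesgue_integral_def mult.commute)
  also have "\<dots> = I"
    by (rule set_lebesgue_integral_period(2)[OF _ I])
      (intro continuous_intros g continuous_on_compose2[OF f]; auto)
  finally show ?thesis .
qed

lemma emeasure_circle_density:
  assumes g: "continuous_on UNIV g" "\<And>\<theta>. g \<theta> \<ge> 0" and I: "(g has_integral I) {0..2*pi}"
  shows "emeasure (circle_density g) UNIV = ennreal I"
proof -
  have [measurable]: "g \<in> borel_measurable borel"
    using g by (auto intro: borel_measurable_continuous_onI)
  have "emeasure (circle_density g) UNIV =
      emeasure (density (restrict_space lborel {0..<2*pi}) g) (space (restrict_space lborel {0..<2*pi}))"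
    unfolding circle_density_def by (subst emeasure_distr) auto
  also have "\<dots> = (\<integral>\<^sup>+\<theta>. g \<theta> \<partial>restrict_space lborel {0..<2*pi})"
    by (subst emeasure_density)
      (auto intro!: nn_integral_cong intro: measurable_restrict_space1 simp: space_restrict_space sets_restrict_space)
  also have "\<dots> = (\<integral>\<^sup>+\<theta>. ennreal (indicator {0..<2*pi} \<theta> *\<^sub>R g \<theta>) \<partial>lborel)"
    by (subst nn_integral_restrict_space) (auto intro!: nn_integral_cong split: split_indicator)
  also have "\<dots> = ennreal (LINT \<theta>:{0..<2*pi}|lborel. g \<theta>)"
    unfolding set_lebesgue_integral_def
    using set_lebesgue_integral_period(1)[OF g(1) I] g(2)
    by (intro nn_integral_eq_integral) (auto simp: set_integrable_def)
  finally show ?thesis using set_lebesgue_integral_period(2)[OF g(1) I] by simp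
qed

lemma emeasure_circle_density_outside: "emeasure (circle_density g) (- sphere 0 1) = 0"
proof -
  have "cis -` (- sphere 0 1) = {}" by auto
  then show ?thesis unfolding circle_density_def by (subst emeasure_distr) auto
qed

section \<open>Averages over the zeros\<close>

lemma sum_count_mult_eq_sum_mset:
  fixes f :: "'a \<Rightarrow> 'b :: comm_semiring_1"
  assumes "finite S" "set_mset A \<subseteq> S"
  shows "(\<Sum>x\<in>S. of_nat (count A x) * f x) = (\<Sum>x\<in>#A. f x)"
  using assms(2)
proof (induction A)
  case (add y A)
  have "(\<Sum>x\<in>S. of_nat (count (add_mset y A) x) * f x) =
      (\<Sum>x\<in>S. of_nat (count A x) * f x + (if x = y then f x else 0))"
    by (intro sum.cong) (auto simp: algebra_simps)
  also have "\<dots> = (\<Sum>x\<in>#A. f x) + f y"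
    using add assms(1) by (simp add: sum.distrib)
  finally show ?case by (simp add: add.commute)
qed auto

text \<open>Positive degree makes the multiset of zeros nonempty, so the pmf is given by
  multiplicities divided by their total, the degree.\<close>

lemma integral_zero_density:
  fixes f :: "complex \<Rightarrow> real"
  assumes f: "continuous_on UNIV f" and p: "degree p > 0"
  shows "(\<integral>z. f z \<partial>zero_density p) = (\<Sum>w\<in>#proots p. f w) / degree p"
proof -
  have size: "size (proots p) = degree p" by (rule size_proots_complex)
  with p have ne: "proots p \<noteq> {#}" by auto
  have "(\<integral>z. f z \<partial>zero_density p) = (\<integral>z. f z \<partial>measure_pmf (pmf_of_multiset (proots p)))"
    unfolding zero_density_def using f
    by (intro integral_distr) (auto intro: borel_measurable_continuous_onI)
  also have "\<dots> = (\<Sum>w\<in>set_mset (proots p). f w * pmf (pmf_of_multiset (proots p)) w)"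
    using ne by (intro integral_measure_pmf_real) auto
  also have "\<dots> = (\<Sum>w\<in>set_mset (proots p). real (count (proots p) w) * f w) / degree p"
    using ne by (simp add: size sum_divide_distrib mult.commute del: count_proots set_count_proots)
  also have "\<dots> = (\<Sum>w\<in>#proots p. f w) / degree p"
    by (subst sum_count_mult_eq_sum_mset) auto
  finally show ?thesis .
qed

section \<open>Weak convergence\<close>

lemma continuous_on_sum_mset:
  fixes f :: "'a \<Rightarrow> 'b :: topological_space \<Rightarrow> 'c :: topological_comm_monoid_add"
  assumes "\<And>w. w \<in># A \<Longrightarrow> continuous_on S (f w)"
  shows "continuous_on S (\<lambda>x. \<Sum>w\<in>#A. f w x)"
  using assms by (induction A) (auto intro: continuous_on_add)

lemma sum_mset_nonneg:
  fixes f :: "'a \<Rightarrow> 'b :: ordered_comm_monoid_add"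
  assumes "\<And>w. w \<in># A \<Longrightarrow> 0 \<le> f w"
  shows "0 \<le> (\<Sum>w\<in>#A. f w)"
  using assms by (induction A) auto

lemma borel_measurable_circle_density:
  fixes f :: "complex \<Rightarrow> real"
  assumes "continuous_on UNIV f"
  shows "f \<in> borel_measurable (circle_density g)"
  using borel_measurable_continuous_onI[OF assms]
  by (simp add: measurable_cong_sets[OF sets_circle_density refl])

section \<open>A monic polynomial with all zeros in the open disc\<close>

locale disc_poly =
  fixes p :: "complex poly"
  assumes monic: "lead_coeff p = 1"
    and roots: "\<And>w. poly p w = 0 \<Longrightarrow> norm w < 1"
begin

definition arg_deriv :: "real \<Rightarrow> real" where
  "arg_deriv \<theta> = (\<Sum>w\<in>#proots p. arg_kernel w \<theta>)"

lemma proots_in_disc: "w \<in># proots p \<Longrightarrow> norm w < 1"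
  using monic roots by (cases "p = 0") auto

lemma continuous_arg_deriv: "continuous_on S arg_deriv"
  unfolding arg_deriv_def
  by (intro continuous_on_sum_mset continuous_on_arg_kernel proots_in_disc)

lemma arg_deriv_nonneg: "arg_deriv \<theta> \<ge> 0"
  unfolding arg_deriv_def by (intro sum_mset_nonneg) (auto intro: arg_kernel_nonneg dest: proots_in_disc)

lemma has_integral_poly_arg_deriv:
  "((\<lambda>\<theta>. Re (poly q (cis \<theta>)) * arg_deriv \<theta>) has_integral
      pi * (\<Sum>w\<in>#proots p. Re (poly q w) + Re (poly q 0))) {0..2*pi}"
proof -
  have "((\<lambda>\<theta>. \<Sum>w\<in>#proots p. Re (poly q (cis \<theta>)) * arg_kernel w \<theta>) has_integral
      (\<Sum>w\<in>#proots p. pi * (Re (poly q w) + Re (poly q 0)))) {0..2*pi}"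
    by (intro has_integral_sum_mset has_integral_poly_arg_kernel proots_in_disc)
  then show ?thesis by (simp only: arg_deriv_def sum_mset_distrib_left)
qed

text \<open>Testing with the constant polynomial 1, each zero contributes
  \<open>pi * (1 + 1)\<close>.\<close>

lemma has_integral_arg_deriv: "(arg_deriv has_integral 2 * pi * degree p) {0..2*pi}"
proof -
  have "(\<Sum>w\<in>#proots p. Re (poly 1 w) + Re (poly 1 0)) = 2 * real (degree p)"
    by (simp flip: size_proots_complex)
  then show ?thesis
    using has_integral_poly_arg_deriv[of 1] by (simp add: ac_simps)
qed

lemma has_real_derivative_arg:
  "continuous_arg p \<phi> \<Longrightarrow> (\<phi> has_real_derivative arg_deriv \<theta>) (at \<theta>)"
  unfolding arg_deriv_def using continuous_arg_has_derivative[OF monic roots] by blast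

lemma arg_measure_eq: "continuous_arg p \<phi> \<Longrightarrow> arg_measure \<phi> = circle_density arg_deriv"
  using has_real_derivative_arg unfolding arg_measure_def
  by (metis DERIV_imp_deriv ext)

lemma emeasure_arg_measure:
  "continuous_arg p \<phi> \<Longrightarrow> emeasure (arg_measure \<phi>) UNIV = ennreal (2 * pi * degree p)"
  unfolding arg_measure_eq
  by (intro emeasure_circle_density continuous_arg_deriv arg_deriv_nonneg has_integral_arg_deriv)

lemma circle_prob_measure_arg:
  assumes "continuous_arg p \<phi>" "degree p > 0"
  shows "circle_prob_measure (scale_measure (ennreal (1 / (2 * pi * degree p))) (arg_measure \<phi>))"
  unfolding circle_prob_measure_def
proof (intro conjI prob_spaceI)
  have "ennreal (1 / (2 * pi * degree p)) * ennreal (2 * pi * degree p) = 1"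
    using assms(2) by (subst ennreal_mult[symmetric]) auto
  then show "emeasure (scale_measure (ennreal (1 / (2 * pi * degree p))) (arg_measure \<phi>))
      (space (scale_measure (ennreal (1 / (2 * pi * degree p))) (arg_measure \<phi>))) = 1"
    using emeasure_arg_measure[OF assms(1)] by (simp add: space_scale_measure arg_measure_def)
qed (auto simp: arg_measure_def emeasure_circle_density_outside)

text \<open>This identity is exact for each polynomial, before any limit: half the average over the
  zeros plus half the value at 0. Weak convergence of the zeros then decides the limit for such test
  functions.\<close>

lemma integral_Re_poly_arg_measure:
  assumes "continuous_arg p \<phi>" "degree p > 0"
  shows "(\<integral>z. Re (poly q z) \<partial>scale_measure (ennreal (1 / (2 * pi * degree p))) (arg_measure \<phi>)) =
    ((\<Sum>w\<in>#proots p. Re (poly q w)) / degree p + Re (poly q 0)) / 2"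
proof -
  have "(\<integral>z. Re (poly q z) \<partial>arg_measure \<phi>) = pi * (\<Sum>w\<in>#proots p. Re (poly q w) + Re (poly q 0))"
    unfolding arg_measure_eq[OF assms(1)]
    by (intro integral_circle_density continuous_intros continuous_arg_deriv arg_deriv_nonneg
        has_integral_poly_arg_deriv)
  also have "(\<Sum>w\<in>#proots p. Re (poly q w) + Re (poly q 0)) =
      (\<Sum>w\<in>#proots p. Re (poly q w)) + degree p * Re (poly q 0)"
    by (simp add: sum_mset.distrib size_proots_complex)
  finally show ?thesis
    using assms(2) by (subst integral_scale_measure)
      (auto simp: arg_measure_def field_simps intro!: borel_measurable_circle_density continuous_intros)
qed

end

text \<open>Weak convergence only tests bounded functions, so the real part of a polynomial is composed with
  a retraction onto the disc, which carries all the zeros and \<open>\<nu>\<close>.\<close>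

definition disc_retract :: "complex \<Rightarrow> complex" where
  "disc_retract z = z / of_real (max 1 (norm z))"

lemma continuous_on_disc_retract: "continuous_on S disc_retract"
  unfolding disc_retract_def by (intro continuous_intros) (auto simp: max_def)

lemma norm_disc_retract: "norm (disc_retract z) \<le> 1"
  by (auto simp: disc_retract_def norm_divide divide_simps)

lemma disc_retract_id: "norm z \<le> 1 \<Longrightarrow> disc_retract z = z"
  by (simp add: disc_retract_def max_def)

section \<open>The limit measure\<close>

definition circle_mean :: "complex measure \<Rightarrow> complex measure" where
  "circle_mean \<nu> = add_measure (scale_measure (1 / 2) \<nu>)
     (scale_measure (1 / 2) (scale_measure (ennreal (1 / (2 * pi))) (circle_density (\<lambda>_. 1))))"

text \<open>The scaling rules for integrals concern factors \<open>ennreal r\<close>, while the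
  limit measure is written with a fraction of extended reals.\<close>

lemma ennreal_half: "(1 / 2 :: ennreal) = ennreal (1 / 2)"
  by (metis divide_ennreal ennreal_1 ennreal_numeral zero_le_numeral zero_le_one zero_less_numeral)

lemma emeasure_circle_density_1: "emeasure (circle_density (\<lambda>_. 1)) UNIV = ennreal (2 * pi)"
  using has_integral_const_real[of "1 :: real" 0 "2*pi"] by (intro emeasure_circle_density) auto

lemma circle_prob_measure_circle_mean:
  assumes \<nu>: "circle_prob_measure \<nu>"
  shows "circle_prob_measure (circle_mean \<nu>)"
  unfolding circle_prob_measure_def
proof (intro conjI prob_spaceI)
  have sets: "sets \<nu> = sets borel" using \<nu> by (simp add: circle_prob_measure_def)
  then have space: "space \<nu> = UNIV" using sets_eq_imp_space_eq by fastforce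
  interpret prob_space \<nu> using \<nu> by (simp add: circle_prob_measure_def)
  have "emeasure (circle_mean \<nu>) (space (circle_mean \<nu>)) =
      ennreal (1 / 2) * emeasure \<nu> UNIV + ennreal (1 / 2) * (ennreal (1 / (2 * pi)) * ennreal (2 * pi))"
    unfolding circle_mean_def using sets emeasure_circle_density_1
    by (simp add: emeasure_add_measure space_scale_measure space ennreal_half mult.assoc)
  also have "emeasure \<nu> UNIV = ennreal 1" using emeasure_space_1 space by simp
  also have "ennreal (1 / 2) * ennreal 1 + ennreal (1 / 2) * (ennreal (1 / (2 * pi)) * ennreal (2 * pi)) = 1"
  proof -
    have "ennreal r * ennreal 1 + ennreal r * (ennreal a * ennreal b) = ennreal (r + r * (a * b))"
      if "r \<ge> 0" "a \<ge> 0" "b \<ge> 0" for r a b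
      using that by (simp flip: ennreal_mult ennreal_plus)
    from this[of "1 / 2" "1 / (2 * pi)" "2 * pi"] show ?thesis by simp
  qed
  finally show "emeasure (circle_mean \<nu>) (space (circle_mean \<nu>)) = 1" .
  show "sets (circle_mean \<nu>) = sets borel" by (simp add: circle_mean_def sets)
  show "emeasure (circle_mean \<nu>) (- sphere 0 1) = 0"
    using \<nu> sets by (simp add: circle_mean_def emeasure_add_measure
        emeasure_circle_density_outside circle_prob_measure_def)
qed

lemma integral_Re_poly_circle_mean:
  assumes \<nu>: "circle_prob_measure \<nu>"
  shows "(\<integral>z. Re (poly q z) \<partial>circle_mean \<nu>) = ((\<integral>z. Re (poly q z) \<partial>\<nu>) + Re (poly q 0)) / 2"
proof -
  have sets: "sets \<nu> = sets borel" using \<nu> by (simp add: circle_prob_measure_def)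
  define f where "f = (\<lambda>z. Re (poly q z))"
  define L where "L = scale_measure (ennreal (1 / (2 * pi))) (circle_density (\<lambda>_. 1))"
  have cont: "continuous_on UNIV f" unfolding f_def by (intro continuous_intros)
  have "circle_prob_measure L"
    unfolding circle_prob_measure_def
  proof (intro conjI prob_spaceI)
    show "emeasure L (space L) = 1"
      by (simp add: L_def space_scale_measure emeasure_circle_density_1 flip: ennreal_mult)
  qed (simp_all add: L_def emeasure_circle_density_outside)
  then have intL: "integrable L f" using cont by (rule integrable_circle)
  have int\<nu>: "integrable \<nu> f" using \<nu> cont by (rule integrable_circle)
  \<comment> \<open>For \<open>w = 0\<close> the kernel is the constant 1, so the kernel formula
    reduces to the mean value property.\<close>
  have "(\<integral>z. f z \<partial>circle_density (\<lambda>_. 1)) = pi * (f 0 + f 0)"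
    using has_integral_poly_arg_kernel[of 0 q]
    by (intro integral_circle_density cont) (simp_all add: f_def arg_kernel_def)
  then have "(\<integral>z. f z \<partial>L) = f 0"
    unfolding L_def by (subst integral_scale_measure) (auto intro: borel_measurable_circle_density cont)
  moreover have "(\<integral>z. f z \<partial>circle_mean \<nu>) = (\<integral>z. f z \<partial>\<nu>) / 2 + (\<integral>z. f z \<partial>L) / 2"
  proof -
    have "sets L = sets borel" by (simp add: L_def)
    then have "(\<integral>z. f z \<partial>add_measure (scale_measure (ennreal r) \<nu>) (scale_measure (ennreal r) L)) =
        r * (\<integral>z. f z \<partial>\<nu>) + r * (\<integral>z. f z \<partial>L)" if "r \<ge> 0" for r
      using that intL int\<nu> sets
      by (subst integral_add_measure) (simp_all add: integral_scale_measure integrable_scale_measure)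
    from this[of "1 / 2"] show ?thesis
      unfolding circle_mean_def ennreal_half L_def[symmetric] by simp
  qed
  ultimately show ?thesis by (simp add: f_def field_simps)
qed

text \<open>An argument with three errors of size \<open>e / 3\<close>: \<open>f\<close> is replaced
  by the real part \<open>h\<close> of a polynomial under \<open>M n\<close> and under the limit,
  and the integrals of \<open>h\<close> converge by the exact formula and the convergence of the
  zeros.\<close>

lemma arg_measure_weak_limit:
  assumes P: "\<And>n. disc_poly (P n)" "\<And>n. degree (P n) = n"
    and \<phi>: "\<And>n. continuous_arg (P n) (\<phi> n)"
    and \<nu>: "circle_prob_measure \<nu>" and lim: "weak_limit (\<lambda>n. zero_density (P n)) \<nu>"
  shows "weak_limit (\<lambda>n. scale_measure (ennreal (1 / (2 * pi * real n))) (arg_measure (\<phi> n)))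
           (circle_mean \<nu>)"
  unfolding weak_limit_def
proof (intro allI impI)
  fix f :: "complex \<Rightarrow> real"
  assume f: "continuous_on UNIV f"
  define M where "M = (\<lambda>n. scale_measure (ennreal (1 / (2 * pi * real n))) (arg_measure (\<phi> n)))"
  have M: "circle_prob_measure (M n)" if "n > 0" for n
    using disc_poly.circle_prob_measure_arg[OF P(1) \<phi>, of n] that by (simp add: M_def P(2))
  have N: "circle_prob_measure (circle_mean \<nu>)" using \<nu> by (rule circle_prob_measure_circle_mean)
  show "(\<lambda>n. \<integral>z. f z \<partial>M n) \<longlonglongrightarrow> (\<integral>z. f z \<partial>circle_mean \<nu>)"
  proof (rule LIMSEQ_I)
    fix e :: real assume e: "e > 0"
    then obtain q where q: "\<And>z. norm z = 1 \<Longrightarrow> \<bar>f z - Re (poly q z)\<bar> < e / 3"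
      using Weierstrass_Re_poly_circle[OF f, of "e / 3"] by auto
    define h where "h = (\<lambda>z. Re (poly q z))"
    have h: "continuous_on UNIV h" unfolding h_def by (intro continuous_intros)
    define H where "H = (\<lambda>z. h (disc_retract z))"
    have H: "continuous_on UNIV H"
      unfolding H_def h_def by (intro continuous_intros continuous_on_disc_retract)
    have "compact (h ` cball 0 1)"
      by (intro compact_continuous_image continuous_on_subset[OF h]) auto
    then have "bounded (h ` cball 0 1)" by (rule compact_imp_bounded)
    then have "bounded (range H)"
      by (rule bounded_subset) (auto simp: H_def norm_disc_retract)
    then have "(\<lambda>n. \<integral>z. H z \<partial>zero_density (P n)) \<longlonglongrightarrow> (\<integral>z. H z \<partial>\<nu>)"
      using lim H unfolding weak_limit_def by blast
    then have "(\<lambda>n. ((\<integral>z. H z \<partial>zero_density (P n)) + h 0) / 2) \<longlonglongrightarrow> ((\<integral>z. H z \<partial>\<nu>) + h 0) / 2"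
      by (intro tendsto_intros) auto
    moreover have "(\<integral>z. H z \<partial>\<nu>) = (\<integral>z. h z \<partial>\<nu>)"
      using \<nu> H h by (rule integral_circle_cong) (simp add: H_def disc_retract_id)
    \<comment> \<open>The zeros lie in the disc, where the bounded function \<open>H\<close> agrees
      with \<open>h\<close>.\<close>
    moreover have "((\<integral>z. H z \<partial>zero_density (P n)) + h 0) / 2 = (\<integral>z. h z \<partial>M n)" if "n > 0" for n
    proof -
      have "(\<Sum>w\<in>#proots (P n). H w) = (\<Sum>w\<in>#proots (P n). h w)"
        by (intro arg_cong[of _ _ sum_mset] image_mset_cong)
          (auto simp: H_def disc_retract_id dest!: disc_poly.proots_in_disc[OF P(1)])
      then have "(\<integral>z. H z \<partial>zero_density (P n)) = (\<Sum>w\<in>#proots (P n). h w) / n"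
        using integral_zero_density[OF H, of "P n"] that P(2) by simp
      then show ?thesis
        using disc_poly.integral_Re_poly_arg_measure[OF P(1) \<phi>, of n q] that
        by (simp add: h_def M_def P(2))
    qed
    ultimately have "(\<lambda>n. \<integral>z. h z \<partial>M n) \<longlonglongrightarrow> ((\<integral>z. h z \<partial>\<nu>) + h 0) / 2"
      by (auto elim!: Lim_transform_eventually intro: eventually_mono[OF eventually_gt_at_top[of 0]])
    then have "(\<lambda>n. \<integral>z. h z \<partial>M n) \<longlonglongrightarrow> (\<integral>z. h z \<partial>circle_mean \<nu>)"
      unfolding h_def integral_Re_poly_circle_mean[OF \<nu>] .
    then obtain n0 where n0: "\<And>n. n \<ge> n0 \<Longrightarrow> \<bar>(\<integral>z. h z \<partial>M n) - (\<integral>z. h z \<partial>circle_mean \<nu>)\<bar> < e / 3"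
      using e LIMSEQ_D[of _ _ "e / 3"] by (metis divide_pos_pos real_norm_def zero_less_numeral)
    show "\<exists>n0. \<forall>n\<ge>n0. norm ((\<integral>z. f z \<partial>M n) - (\<integral>z. f z \<partial>circle_mean \<nu>)) < e"
    \<comment> \<open>At \<open>n = 0\<close> the scaling factor is \<open>1 / 0 = 0\<close>, so
      \<open>M 0\<close> is the zero measure and the bound for probability measures applies only
      from 1 on.\<close>
    proof (intro exI[of _ "max 1 n0"] allI impI)
      fix n assume n: "n \<ge> max 1 n0"
      have near: "\<bar>f z - h z\<bar> \<le> e / 3" if "norm z = 1" for z
        using q[OF that] by (simp add: h_def)
      have "\<bar>(\<integral>z. f z \<partial>M n) - (\<integral>z. h z \<partial>M n)\<bar> \<le> e / 3"
        using n by (intro circle_integral_diff_le[OF M f h near]) auto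
      moreover have "\<bar>(\<integral>z. f z \<partial>circle_mean \<nu>) - (\<integral>z. h z \<partial>circle_mean \<nu>)\<bar> \<le> e / 3"
        by (intro circle_integral_diff_le[OF N f h near])
      ultimately show "norm ((\<integral>z. f z \<partial>M n) - (\<integral>z. f z \<partial>circle_mean \<nu>)) < e"
        using n0[of n] n by (simp only: real_norm_def) linarith
    qed
  qed
qed

theorem theorem4p13:
  fixes \<mu> :: "complex measure" and \<Phi> :: "nat \<Rightarrow> complex poly"
  assumes "circle_prob_measure \<mu>"
    and "nontrivial_measure \<mu>"
    and "monic_orthogonal_polys \<mu> \<Phi>"
  shows "(\<forall>n. (\<exists>\<phi>. continuous_arg (\<Phi> n) \<phi>) \<and>
              (\<forall>\<phi>. continuous_arg (\<Phi> n) \<phi> \<longrightarrow>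
                 mono \<phi> \<and> (\<forall>\<theta>. \<phi> differentiable (at \<theta>)) \<and>
                 emeasure (arg_measure \<phi>) (space (arg_measure \<phi>)) = ennreal (2 * pi * real n))) \<and>
         (\<forall>(\<phi> :: nat \<Rightarrow> real \<Rightarrow> real) (\<nu> :: complex measure).
              (\<forall>n. continuous_arg (\<Phi> n) (\<phi> n)) \<longrightarrow>
              circle_prob_measure \<nu> \<longrightarrow>
              weak_limit (\<lambda>n. zero_density (\<Phi> n)) \<nu> \<longrightarrow>
              weak_limit (\<lambda>n. scale_measure (ennreal (1 / (2 * pi * real n))) (arg_measure (\<phi> n)))
                (add_measure (scale_measure (1 / 2) \<nu>)
                   (scale_measure (1 / 2)
                      (scale_measure (ennreal (1 / (2 * pi))) (circle_density (\<lambda>_. 1))))))"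
proof -
  have deg: "degree (\<Phi> n) = n" and lc: "lead_coeff (\<Phi> n) = 1" for n
    using assms(3) unfolding monic_orthogonal_polys_def by blast+
  \<comment> \<open>Orthogonality and nontriviality of \<mu> enter here, by placing the zeros in the
    disc; the rest concerns monic polynomials of degree \<open>n\<close> with such zeros.\<close>
  have P: "disc_poly (\<Phi> n)" for n
    using lc orthogonal_poly_roots_in_disc[OF assms] by unfold_locales
  have "\<exists>\<phi>. continuous_arg (\<Phi> n) \<phi>" for n
    by (rule exI, rule continuous_arg_arg_lift[OF disc_poly.monic[OF P] disc_poly.roots[OF P]])
  moreover have "mono \<phi>" "\<phi> differentiable (at \<theta>)"
    "emeasure (arg_measure \<phi>) (space (arg_measure \<phi>)) = ennreal (2 * pi * real n)"
    if \<phi>: "continuous_arg (\<Phi> n) \<phi>" for n \<phi> \<theta>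
  proof -
    note deriv = disc_poly.has_real_derivative_arg[OF P \<phi>]
    show "mono \<phi>"
    proof (rule monoI)
      fix x y :: real
      assume "x \<le> y"
      then show "\<phi> x \<le> \<phi> y"
      proof (rule DERIV_nonneg_imp_nondecreasing)
        show "\<exists>d. (\<phi> has_real_derivative d) (at t) \<and> d \<ge> 0" for t
          using deriv[of t] disc_poly.arg_deriv_nonneg[OF P, of n t] by blast
      qed
    qed
    show "\<phi> differentiable (at \<theta>)"
      unfolding real_differentiable_def using deriv[of \<theta>] by (rule exI)
    show "emeasure (arg_measure \<phi>) (space (arg_measure \<phi>)) = ennreal (2 * pi * real n)"
      using disc_poly.emeasure_arg_measure[OF P \<phi>] by (simp add: deg arg_measure_def)
  qed
  ultimately show ?thesis
    using arg_measure_weak_limit[of \<Phi>, OF P deg] unfolding circle_mean_def by simp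
qed

end
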